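(* Let $P$ be a finite connected poset and let $M_P$ be the associated thin representation of its Hasse quiver over a field $K$. The faces of $\mathcal{D}(M_P)$ correspond to connected compatible partitions of $P$.
   Context: The Hasse diagram of $P$ is the quiver with vertex set $P$ and an arrow $y\to x$ for every covering relation $x\lessdot y$; $P$ is connected if its Hasse diagram is connected. $M_P$ is the representation of this quiver with a one-dimensional vector space $K$ at every vertex and the identity map at every arrow. For a partition $\pi=(P_1,\dots,P_k)$ of $P$, define $P_i\leq_\pi P_j$ if and only if there are $p_i\in P_i$, $p_j\in P_j$ with $p_i\le p_j$ in $P$. The partition $\pi$ is compatible if the transitive closure of $\leq_\pi$ is a partial order, and connected if each $P_i$ is connected as a subposet of $P$. For $\mathbf{v}\in\mathbb{R}^P$, a non-zero representation $M$ is $\mathbf{v}$-semistable if $\langle\mathbf{v},\underline{\dim}M\rangle=0$ and $\langle\mathbf{v},\underline{\dim}L\rangle\le0$ for every proper subrepresentation $L$, where $\underline{\dim}$ is the dimension vector and $\langle-,-\rangle$ the standard inner product; $\mathcal{D}(M)$ is the cone of all $\mathbf{v}\in\mathbb{R}^P$ such that $M$ is $\mathbf{v}$-semistable. A face of a cone $C$ is a subset of the form $\{\mathbf{v}\in C\mid\langle\mathbf{a},\mathbf{v}\rangle\ge\langle\mathbf{a},\mathbf{w}\rangle\ \forall\,\mathbf{w}\in C\}$ for some vector $\mathbf{a}$.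
   Formalization: "Faces" means non-empty faces: under the stated definition the empty set is also a face once P has at least two elements, and it corresponds to no partition. *)

theory Defs
  imports "HOL-Analysis.Analysis" "HOL-Library.Disjoint_Sets"
begin

text \<open>
  A quiver without multiple arrows is given by its set of arrows; the pair \<open>(s, t)\<close> is the
  arrow from \<open>s\<close> to \<open>t\<close>. All vector spaces of a representation are subspaces of one ambient
  vector space with scalar multiplication \<open>smul\<close>. The map of an arrow is a total function of which
  only the values on the subspace at the source are relevant, also for linearity.
\<close>

record ('q, 'v) rep =
  space_at :: "'q \<Rightarrow> 'v set"
  map_at :: "'q \<Rightarrow> 'q \<Rightarrow> 'v \<Rightarrow> 'v"

definition is_representation ::
  "('k::field \<Rightarrow> 'v::ab_group_add \<Rightarrow> 'v) \<Rightarrow> ('q \<times> 'q) set \<Rightarrow> ('q, 'v) rep \<Rightarrow> bool"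
  where "is_representation smul Q M \<longleftrightarrow>
    vector_space smul \<and>
    (\<forall>i. module.subspace smul (space_at M i) \<and>
         (\<exists>B. finite B \<and> space_at M i = module.span smul B)) \<and>
    (\<forall>(s, t) \<in> Q.
       map_at M s t ` space_at M s \<subseteq> space_at M t \<and>
       (\<forall>x \<in> space_at M s. \<forall>y \<in> space_at M s.
          map_at M s t (x + y) = map_at M s t x + map_at M s t y) \<and>
       (\<forall>c. \<forall>x \<in> space_at M s. map_at M s t (smul c x) = smul c (map_at M s t x)))"

text \<open>A subrepresentation is given by its subspaces, since its maps are restrictions.\<close>

definition subrepresentation ::
  "('k::field \<Rightarrow> 'v::ab_group_add \<Rightarrow> 'v) \<Rightarrow> ('q \<times> 'q) set \<Rightarrow> ('q, 'v) rep \<Rightarrow> ('q \<Rightarrow> 'v set) \<Rightarrow> bool"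
  where "subrepresentation smul Q M L \<longleftrightarrow>
    (\<forall>i. module.subspace smul (L i) \<and> L i \<subseteq> space_at M i) \<and>
    (\<forall>(s, t) \<in> Q. map_at M s t ` L s \<subseteq> L t)"

definition dim_vector ::
  "('k::field \<Rightarrow> 'v::ab_group_add \<Rightarrow> 'v) \<Rightarrow> ('q::finite \<Rightarrow> 'v set) \<Rightarrow> real ^ 'q"
  where "dim_vector smul L = (\<chi> i. real (vector_space.dim smul (L i)))"

definition semistable ::
  "('k::field \<Rightarrow> 'v::ab_group_add \<Rightarrow> 'v) \<Rightarrow> ('q::finite \<times> 'q) set \<Rightarrow> real ^ 'q \<Rightarrow> ('q, 'v) rep \<Rightarrow> bool"
  where "semistable smul Q v M \<longleftrightarrow>
    is_representation smul Q M \<and>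
    (\<exists>i. space_at M i \<noteq> {0}) \<and>
    v \<bullet> dim_vector smul (space_at M) = 0 \<and>
    (\<forall>L. subrepresentation smul Q M L \<and> L \<noteq> space_at M \<longrightarrow> v \<bullet> dim_vector smul L \<le> 0)"

definition semistability_cone ::
  "('k::field \<Rightarrow> 'v::ab_group_add \<Rightarrow> 'v) \<Rightarrow> ('q::finite \<times> 'q) set \<Rightarrow> ('q, 'v) rep \<Rightarrow> (real ^ 'q) set"
  where "semistability_cone smul Q M = {v. semistable smul Q v M}"

text \<open>
  If \<open>a\<close> is not bounded above on \<open>C\<close>, the set of maximisers is empty, so that \<open>{}\<close> satisfies this
  predicate for every cone \<open>C \<noteq> {0}\<close>.
  Partitions correspond to the nonempty faces only.
\<close>

definition is_face :: "'a::real_inner set \<Rightarrow> 'a set \<Rightarrow> bool"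
  where "is_face C F \<longleftrightarrow> (\<exists>a. F = {v \<in> C. \<forall>w \<in> C. a \<bullet> v \<ge> a \<bullet> w})"

text \<open>
  Arrows of the Hasse diagram of the subposet \<open>A\<close>; coverings are taken within \<open>A\<close>, and arrows
  point from the larger to the smaller element.
\<close>

definition hasse :: "'p::order set \<Rightarrow> ('p \<times> 'p) set"
  where "hasse A = {(y, x). x \<in> A \<and> y \<in> A \<and> x < y \<and> \<not> (\<exists>z \<in> A. x < z \<and> z < y)}"

definition connected_poset :: "'p::order set \<Rightarrow> bool"
  where "connected_poset A \<longleftrightarrow> (\<forall>x \<in> A. \<forall>y \<in> A. (x, y) \<in> (hasse A \<union> (hasse A)\<inverse>)\<^sup>*)"

definition block_le :: "'p::order set set \<Rightarrow> ('p set \<times> 'p set) set"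
  where "block_le \<pi> = {(A, B). A \<in> \<pi> \<and> B \<in> \<pi> \<and> (\<exists>a \<in> A. \<exists>b \<in> B. a \<le> b)}"

definition compatible_partition :: "'p::order set set \<Rightarrow> bool"
  where "compatible_partition \<pi> \<longleftrightarrow> partition_on UNIV \<pi> \<and> partial_order_on \<pi> ((block_le \<pi>)\<^sup>+)"

definition connected_partition :: "'p::order set set \<Rightarrow> bool"
  where "connected_partition \<pi> \<longleftrightarrow> partition_on UNIV \<pi> \<and> (\<forall>A \<in> \<pi>. connected_poset A)"

definition thin_rep :: "('p::order, 'k::field) rep"
  where "thin_rep = \<lparr>space_at = (\<lambda>_. UNIV), map_at = (\<lambda>_ _. id)\<rparr>"

definition thin_cone :: "'k::field itself \<Rightarrow> (real ^ 'p::{finite, order}) set"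
  where "thin_cone _ =
    semistability_cone ((*) :: 'k \<Rightarrow> 'k \<Rightarrow> 'k) (hasse (UNIV :: 'p set)) thin_rep"

lemma is_representation_thin_rep:
  "is_representation ((*) :: 'k::field \<Rightarrow> 'k \<Rightarrow> 'k) (hasse UNIV) (thin_rep :: ('p::order, 'k) rep)"
proof -
  have "(UNIV :: 'k set) = vector_space_over_itself.span {1}"
    by (auto simp: vector_space_over_itself.span_singleton)
  then have "\<exists>B. finite B \<and> (UNIV :: 'k set) = vector_space_over_itself.span B" by blast
  then show ?thesis using vector_space_over_itself.vector_space_axioms
    by (auto simp: is_representation_def thin_rep_def algebra_simps)
qed

text \<open>
  The subset of the cone attached to a partition: the vectors orthogonal to the dimension vector
  (the indicator vector) of every block.
\<close>

definition partition_face :: "(real ^ 'p::finite) set \<Rightarrow> 'p set set \<Rightarrow> (real ^ 'p) set"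
  where "partition_face C \<pi> = {v \<in> C. \<forall>A \<in> \<pi>. (\<Sum>p \<in> A. v $ p) = 0}"

end

theory Submission
  imports Defs
begin

text \<open>
  A subspace of the one-dimensional space \<open>K\<close> is \<open>0\<close> or \<open>K\<close>, so a subrepresentation of the thin
  representation is the same thing as a down-set of the poset. Hence its semistability cone \<open>C\<close>
  consists of the vectors whose coordinates have total sum \<open>0\<close> and sum at most \<open>0\<close> on every
  down-set (\<open>thin_cone_eq_polar_cone\<close>).

  The functionals that are nonpositive on \<open>C\<close> are exactly the antitone functions on the poset: \<open>C\<close>
  contains \<open>e\<^sub>y - e\<^sub>x\<close> whenever \<open>x \<le> y\<close>, and conversely an antitone function is a constant plus a
  nonnegative combination of indicators of down-sets (\<open>antitone_inner_nonpos\<close>). A linear functional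
  that attains its maximum on a cone has maximum \<open>0\<close>, so the nonempty faces of \<open>C\<close> are the kernels
  in \<open>C\<close> of the antitone functions.

  Kernels are related to partitions by a perturbation argument (\<open>partition_face_eq_kernel\<close>). Let \<open>a\<close>
  be constant on the blocks of a partition and strictly decreasing along comparable elements of
  different blocks. If \<open>B\<close> is a block, then \<open>a\<close> plus a small multiple, of either sign, of the
  indicator of \<open>B\<close> is still antitone. So a vector of \<open>C\<close> that \<open>a\<close> annihilates has sum \<open>0\<close> on \<open>B\<close>,
  and the kernel of \<open>a\<close> in \<open>C\<close> is the face attached to the partition. This is used twice. For a
  compatible partition such an \<open>a\<close> exists: count the blocks above the block of a given element.
  Conversely, the connected components of the fibres of an antitone \<open>a\<close> form a connected partition
  for which \<open>a\<close> has this property, and it is compatible because \<open>a\<close> strictly decreases along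
  chains of different blocks.

  Finally, the face determines the partition. For comparable \<open>x \<le> y\<close> the vector \<open>e\<^sub>y - e\<^sub>x\<close> lies in
  the face if and only if \<open>x\<close> and \<open>y\<close> lie in a common block, and a connected block is generated by
  such comparabilities (\<open>connected_partition_refines\<close>).
\<close>

section \<open>Comparability and covering relations\<close>

text \<open>In a finite subposet every interval is exhausted by refining it, here by induction on the
  number of its interior points.\<close>

lemma hasse_path:
  fixes A :: "'p::order set"
  assumes "finite A" "x \<in> A" "y \<in> A" "x \<le> y"
  shows "(y, x) \<in> (hasse A)\<^sup>*"
  using assms(2-)
proof (induction "card {z \<in> A. x < z \<and> z < y}" arbitrary: x y rule: less_induct)
  case less
  show ?case
  proof (cases "x = y \<or> (y, x) \<in> hasse A")
    case True
    then show ?thesis by auto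
  next
    case False
    then obtain z where z: "z \<in> A" "x < z" "z < y"
      using less.prems unfolding hasse_def by (auto simp: order.order_iff_strict)
    have "{w \<in> A. z < w \<and> w < y} \<subset> {w \<in> A. x < w \<and> w < y}"
      "{w \<in> A. x < w \<and> w < z} \<subset> {w \<in> A. x < w \<and> w < y}"
      using z by (auto dest: less_trans)
    then have "card {w \<in> A. z < w \<and> w < y} < card {w \<in> A. x < w \<and> w < y}"
      "card {w \<in> A. x < w \<and> w < z} < card {w \<in> A. x < w \<and> w < y}"
      using assms(1) by (auto intro!: psubset_card_mono)
    then have "(y, z) \<in> (hasse A)\<^sup>*" "(z, x) \<in> (hasse A)\<^sup>*"
      using less.hyps[of z y] less.hyps[of x z] less.prems z by auto
    then show ?thesis by (rule rtrancl_trans)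
  qed
qed

text \<open>Connectedness of a finite subposet may thus be tested with comparabilities instead of
  coverings. They are easier to handle because, unlike coverings, they do not depend on the
  subposet.\<close>

lemma zigzag_connected:
  fixes x y :: "'p::order"
  assumes "finite A" "x \<in> A" "y \<in> A" "x \<le> y \<or> y \<le> x"
  shows "(x, y) \<in> (hasse A \<union> (hasse A)\<inverse>)\<^sup>*"
proof -
  have sub: "(hasse A)\<^sup>* \<subseteq> (hasse A \<union> (hasse A)\<inverse>)\<^sup>*" by (rule rtrancl_mono) auto
  have "((hasse A)\<inverse>)\<^sup>* \<subseteq> (hasse A \<union> (hasse A)\<inverse>)\<^sup>*" by (rule rtrancl_mono) auto
  then show ?thesis
    using assms sub hasse_path[of A x y] hasse_path[of A y x]
    by (auto simp: rtrancl_converse)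
qed

section \<open>The semistability cone in terms of down-sets\<close>

definition down_closed :: "'p::order set \<Rightarrow> bool"
  where "down_closed D \<longleftrightarrow> (\<forall>y \<in> D. \<forall>x \<le> y. x \<in> D)"

text \<open>This is the polar of the cone of antitone functions: a functional is nonpositive on it if and
  only if it is antitone, by \<open>antitone_inner_nonpos\<close> and \<open>root_in_polar_cone\<close>.\<close>

definition polar_cone :: "(real ^ 'p::{finite, order}) set"
  where "polar_cone = {v. (\<Sum>p\<in>UNIV. v $ p) = 0 \<and> (\<forall>D. down_closed D \<longrightarrow> (\<Sum>p\<in>D. v $ p) \<le> 0)}"

lemma subspace_field_cases:
  fixes S :: "'k::field set"
  assumes "module.subspace (*) S"
  shows "S = {0} \<or> S = UNIV"
proof (cases "S = {0}")
  case False
  have S: "vector_space_over_itself.subspace S" using assms .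
  then have "0 \<in> S" by (rule vector_space_over_itself.subspace_0)
  then obtain x where x: "x \<in> S" "x \<noteq> 0" using False by auto
  have "c \<in> S" for c
    using vector_space_over_itself.subspace_scale[OF S x(1), of "c / x"] x(2) by simp
  then show ?thesis by auto
qed simp

lemma inner_dim_vector_field:
  fixes L :: "'p::finite \<Rightarrow> 'k::field set"
  assumes "\<forall>i. L i = {0} \<or> L i = UNIV"
  shows "v \<bullet> dim_vector (*) L = (\<Sum>p\<in>{p. L p = UNIV}. v $ p)"
proof -
  have 0: "vector_space.dim ((*) :: 'k \<Rightarrow> 'k \<Rightarrow> 'k) {0} = 0"
    using vector_space_over_itself.dim_singleton[of "0 :: 'k"] by simp
  have 1: "vector_space.dim ((*) :: 'k \<Rightarrow> 'k \<Rightarrow> 'k) UNIV = 1"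
    using vector_space_over_itself.dim_UNIV by simp
  have "(UNIV :: 'k set) \<noteq> {0}" using one_neq_zero by blast
  then have "vector_space.dim (*) (L p) = (if L p = UNIV then 1 else 0)" for p
    using assms 0 1 by metis
  then have "v \<bullet> dim_vector (*) L = (\<Sum>p\<in>UNIV. v $ p * (if L p = UNIV then 1 else 0))"
    by (auto simp: dim_vector_def inner_vec_def intro!: sum.cong)
  also have "\<dots> = (\<Sum>p\<in>{p. L p = UNIV}. v $ p)"
    by (simp add: if_distrib sum.If_cases cong: if_cong)
  finally show ?thesis .
qed

text \<open>Taking the supports of the subspaces turns subrepresentations into down-sets: all maps are
  identities and arrows point downwards, so an arrow out of a point of the support keeps its target
  in the support. The exclusion of the improper subrepresentation is harmless, since on it the
  vector has value \<open>0\<close> anyway.\<close>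

lemma thin_cone_eq_polar_cone:
  "thin_cone TYPE('k::field) = (polar_cone :: (real ^ 'p::{finite, order}) set)"
proof (rule set_eqI)
  fix v :: "real ^ 'p::{finite, order}"
  let ?M = "thin_rep :: ('p, 'k) rep" and ?Q = "hasse (UNIV :: 'p set)"
  have ne: "(UNIV :: 'k set) \<noteq> {0}" using one_neq_zero by blast
  have space: "space_at ?M = (\<lambda>_. UNIV)" by (simp add: thin_rep_def)
  have total: "v \<bullet> dim_vector (*) (space_at ?M) = (\<Sum>p\<in>UNIV. v $ p)"
    using inner_dim_vector_field[of "space_at ?M" v] by (simp add: space)
  have sub: "(\<forall>L. subrepresentation (*) ?Q ?M L \<and> L \<noteq> space_at ?M \<longrightarrow> v \<bullet> dim_vector (*) L \<le> 0)
    \<longleftrightarrow> (\<forall>D. down_closed D \<longrightarrow> (\<Sum>p\<in>D. v $ p) \<le> 0)" (is "?l \<longleftrightarrow> ?r")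
    if zero: "(\<Sum>p\<in>UNIV. v $ p) = 0"
  proof
    assume l: ?l
    show ?r
    proof (intro allI impI)
      fix D :: "'p set"
      assume D: "down_closed D"
      define L where "L p = (if p \<in> D then UNIV else {0 :: 'k})" for p
      have D_eq: "{p. L p = UNIV} = D" using ne by (auto simp: L_def)
      have val: "v \<bullet> dim_vector (*) L = (\<Sum>p\<in>D. v $ p)"
        using inner_dim_vector_field[of L v] by (simp add: D_eq) (simp add: L_def)
      have "subrepresentation (*) ?Q ?M L"
        using D vector_space_over_itself.subspace_UNIV vector_space_over_itself.subspace_single_0
        by (auto simp: subrepresentation_def thin_rep_def L_def hasse_def down_closed_def
            dest: less_imp_le)
      then show "(\<Sum>p\<in>D. v $ p) \<le> 0"
        using l val zero total by (cases "L = space_at ?M") auto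
    qed
  next
    assume r: ?r
    show ?l
    proof (intro allI impI, elim conjE)
      fix L
      assume L: "subrepresentation (*) ?Q ?M L"
      have cases: "\<forall>i. L i = {0} \<or> L i = UNIV"
        using L by (auto simp: subrepresentation_def dest!: subspace_field_cases)
      have step: "L s \<subseteq> L t" if "(s, t) \<in> ?Q" for s t
        using L that by (auto simp: subrepresentation_def thin_rep_def)
      have "L s \<subseteq> L t" if "(s, t) \<in> ?Q\<^sup>*" for s t
        using that by induction (use step in auto)
      then have "L y \<subseteq> L x" if "x \<le> y" for x y
        using hasse_path[of UNIV x y] that by simp
      then have "down_closed {p. L p = UNIV}"
        unfolding down_closed_def by blast
      then show "v \<bullet> dim_vector (*) L \<le> 0"
        using r inner_dim_vector_field[OF cases] by auto
    qed
  qed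
  show "v \<in> thin_cone TYPE('k) \<longleftrightarrow> v \<in> polar_cone"
    using sub total is_representation_thin_rep[where ?'k = 'k and ?'p = 'p] ne
    by (auto simp: thin_cone_def semistability_cone_def semistable_def polar_cone_def space)
qed

section \<open>Antitone functionals\<close>

text \<open>
  Summation by parts. Let \<open>m\<close> be the least value of \<open>a\<close>, let \<open>m + d\<close> be the next one, and let \<open>I\<close>
  be the down-set on which \<open>a\<close> exceeds \<open>m\<close>. Lowering \<open>a\<close> by \<open>d\<close> on \<open>I\<close> merges the two least values
  and keeps the function antitone, while the inner product changes by \<open>d\<close> times the nonpositive
  sum over \<open>I\<close>. Once \<open>a\<close> is constant, the inner product is a multiple of the total sum.
\<close>

lemma antitone_inner_nonpos:
  fixes a v :: "real ^ 'p::{finite, order}"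
  assumes "v \<in> polar_cone" "\<And>x y. x \<le> y \<Longrightarrow> a $ y \<le> a $ x"
  shows "a \<bullet> v \<le> 0"
  using assms(2)
proof (induction "card (range (($) a))" arbitrary: a rule: less_induct)
  case less
  define m where "m = Min (range (($) a))"
  define I where "I = {p. a $ p > m}"
  have m: "m \<in> range (($) a)" "\<And>p. m \<le> a $ p" by (auto simp: m_def)
  show ?case
  proof (cases "I = {}")
    case True
    then have "a $ p = m" for p using m(2)[of p] by (auto simp: I_def not_less intro: antisym)
    then show ?thesis
      using assms(1) by (simp add: inner_vec_def polar_cone_def flip: sum_distrib_left)
  next
    case False
    define d where "d = Min (($) a ` I) - m"
    have "Min (($) a ` I) \<in> ($) a ` I" using False by (intro Min_in) auto
    then obtain q where q: "q \<in> I" "a $ q = m + d" by (auto simp: d_def)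
    have d: "d > 0" using q by (auto simp: I_def)
    have dI: "m + d \<le> a $ p" if "p \<in> I" for p using that by (auto simp: d_def)
    define b where "b = (\<chi> p. if p \<in> I then a $ p - d else a $ p)"
    have notI: "a $ p = m" if "p \<notin> I" for p using that m(2)[of p] by (simp add: I_def)
    have anti: "b $ y \<le> b $ x" if "x \<le> y" for x y
      using less.prems[OF that] dI[of x] dI[of y] notI[of x] notI[of y] d
      by (cases "x \<in> I"; cases "y \<in> I") (auto simp: b_def I_def)
    \<comment> \<open>The values of \<open>b\<close> are those of \<open>a\<close> other than \<open>m\<close>, all shifted by \<open>d\<close>: outside \<open>I\<close> the
      value \<open>m\<close> of \<open>b\<close> is the shift of the value \<open>m + d\<close> that \<open>a\<close> takes at \<open>q\<close>.\<close>
    have "range (($) b) \<subseteq> (\<lambda>t. t - d) ` (range (($) a) - {m})"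
    proof
      fix t assume "t \<in> range (($) b)"
      then obtain p where p: "t = b $ p" by auto
      show "t \<in> (\<lambda>t. t - d) ` (range (($) a) - {m})"
      proof (cases "p \<in> I")
        case True
        then show ?thesis
          using p by (intro image_eqI[of _ _ "a $ p"]) (auto simp: b_def I_def)
      next
        case False
        have "a $ q \<in> range (($) a) - {m}" using q(1) by (auto simp: I_def)
        then show ?thesis
          using p q(2) notI[OF False] False by (intro image_eqI[of _ _ "a $ q"]) (auto simp: b_def)
      qed
    qed
    then have "card (range (($) b)) \<le> card (range (($) a) - {m})"
      by (rule surj_card_le[rotated]) simp
    also have "\<dots> < card (range (($) a))" using m(1) by (intro card_Diff1_less) auto
    finally have IH: "b \<bullet> v \<le> 0" using less.hyps anti by blast
    have "down_closed I"
      using less.prems unfolding down_closed_def I_def by (auto intro: less_le_trans)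
    then have "(\<Sum>p\<in>I. v $ p) \<le> 0" using assms(1) by (simp add: polar_cone_def)
    then have "d * (\<Sum>p\<in>I. v $ p) \<le> 0" using d by (simp add: mult_le_0_iff)
    moreover have "a \<bullet> v = b \<bullet> v + d * (\<Sum>p\<in>I. v $ p)"
    proof -
      have "d * (\<Sum>p\<in>I. v $ p) = (\<Sum>p\<in>UNIV. if p \<in> I then d * v $ p else 0)"
        by (simp add: sum_distrib_left sum.If_cases)
      then show ?thesis
        by (simp add: inner_vec_def flip: sum.distrib)
          (rule sum.cong, auto simp: b_def algebra_simps)
    qed
    ultimately show ?thesis using IH by simp
  qed
qed

lemma root_sum:
  fixes x y :: "'p::finite"
  shows "(\<Sum>p\<in>D. (axis y 1 :: real ^ 'p) $ p - axis x 1 $ p) = of_bool (y \<in> D) - of_bool (x \<in> D)"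
  by (simp add: axis_def sum_subtractf sum.delta of_bool_def)

text \<open>A down-set that contains \<open>y\<close> contains every \<open>x \<le> y\<close>. These vectors serve as test vectors, both
  for functionals and for faces.\<close>

lemma root_in_polar_cone:
  fixes x y :: "'p::{finite, order}"
  assumes "x \<le> y"
  shows "axis y 1 - axis x 1 \<in> polar_cone"
  using assms by (auto simp: polar_cone_def down_closed_def root_sum)

lemma zero_in_polar_cone: "0 \<in> polar_cone"
  by (simp add: polar_cone_def)

text \<open>On a cone the maximum of a linear functional, if attained, is \<open>0\<close>: doubling a maximiser must not
  increase the value. Testing the functional on the vectors \<open>e\<^sub>y - e\<^sub>x\<close> then gives antitonicity.\<close>

lemma nonempty_face_functional:
  fixes F :: "(real ^ 'p::{finite, order}) set"
  assumes "is_face polar_cone F" "F \<noteq> {}"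
  obtains a where "\<And>x y. x \<le> y \<Longrightarrow> a $ y \<le> a $ x" "F = {v \<in> polar_cone. a \<bullet> v = 0}"
proof -
  obtain a where a: "F = {v \<in> polar_cone. \<forall>w\<in>polar_cone. a \<bullet> v \<ge> a \<bullet> w}"
    using assms(1) unfolding is_face_def by auto
  then obtain u where u: "u \<in> polar_cone" "\<And>w. w \<in> polar_cone \<Longrightarrow> a \<bullet> w \<le> a \<bullet> u"
    using assms(2) by auto
  have "2 *\<^sub>R u \<in> polar_cone"
    using u(1) by (simp add: polar_cone_def flip: sum_distrib_left)
  from u(2)[OF this] have "a \<bullet> u \<le> 0" by simp
  then have nonpos: "a \<bullet> w \<le> 0" if "w \<in> polar_cone" for w
    using u(2)[OF that] by simp
  show ?thesis
  proof (rule that)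
    show "a $ y \<le> a $ x" if "x \<le> y" for x y
      using nonpos[OF root_in_polar_cone[OF that]] by (simp add: inner_diff_right inner_axis)
    show "F = {v \<in> polar_cone. a \<bullet> v = 0}"
    proof -
      have "(\<forall>w\<in>polar_cone. a \<bullet> w \<le> a \<bullet> v) \<longleftrightarrow> a \<bullet> v = 0" if "v \<in> polar_cone" for v
        using nonpos that zero_in_polar_cone by (metis antisym inner_zero_right)
      then show ?thesis unfolding a by blast
    qed
  qed
qed

section \<open>Partitions and faces\<close>

lemma block_containing:
  assumes "partition_on UNIV \<pi>"
  obtains A where "A \<in> \<pi>" "x \<in> A"
  using assms partition_onD1 by (metis UNIV_I UnionE)

lemma block_member:
  assumes "partition_on UNIV \<pi>" "A \<in> \<pi>"
  obtains x where "x \<in> A"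
  using assms partition_onD3 by (metis ex_in_conv)

lemma block_unique:
  assumes "partition_on UNIV \<pi>" "A \<in> \<pi>" "B \<in> \<pi>" "x \<in> A" "x \<in> B"
  shows "A = B"
  using assms partition_onD2 disjointD by (metis IntI empty_iff)

text \<open>
  The kernel of \<open>a\<close> contains the partition face because \<open>a\<close> is constant on blocks. For the converse,
  \<open>e\<close> is at most the least positive difference of values of \<open>a\<close>. Adding to \<open>a\<close> a multiple \<open>s\<close> of
  the indicator of a block \<open>B\<close>, where \<open>\<bar>s\<bar> \<le> e\<close>, then cannot destroy antitonicity: inside a block
  nothing changes relatively, and across blocks the gap of \<open>a\<close> dominates. Both signs of \<open>s\<close> together
  force the sum over \<open>B\<close> to vanish.
\<close>

lemma partition_face_eq_kernel:
  fixes a :: "real ^ 'p::{finite, order}"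
  assumes part: "partition_on UNIV \<pi>"
    and const: "\<And>A x y. A \<in> \<pi> \<Longrightarrow> x \<in> A \<Longrightarrow> y \<in> A \<Longrightarrow> a $ x = a $ y"
    and strict: "\<And>A B x y. A \<in> \<pi> \<Longrightarrow> B \<in> \<pi> \<Longrightarrow> A \<noteq> B \<Longrightarrow> x \<in> A \<Longrightarrow> y \<in> B \<Longrightarrow> x \<le> y \<Longrightarrow> a $ y < a $ x"
  shows "partition_face polar_cone \<pi> = {v \<in> polar_cone. a \<bullet> v = 0}"
proof (intro equalityI subsetI)
  fix v assume "v \<in> partition_face polar_cone \<pi>"
  then have v: "v \<in> polar_cone" "\<And>A. A \<in> \<pi> \<Longrightarrow> (\<Sum>p\<in>A. v $ p) = 0"
    by (auto simp: partition_face_def)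
  have "a \<bullet> v = (\<Sum>p\<in>\<Union>\<pi>. a $ p * v $ p)"
    using part by (simp add: inner_vec_def partition_on_def)
  also have "\<dots> = (\<Sum>A\<in>\<pi>. \<Sum>p\<in>A. a $ p * v $ p)"
    using block_unique[OF part] by (intro sum.UNION_disjoint[of \<pi> "\<lambda>A. A", simplified]) auto
  also have "\<dots> = 0"
  proof (rule sum.neutral, rule ballI)
    fix A assume A: "A \<in> \<pi>"
    then obtain q where q: "q \<in> A" using block_member[OF part] by metis
    have "(\<Sum>p\<in>A. a $ p * v $ p) = (\<Sum>p\<in>A. a $ q * v $ p)"
      using const[OF A _ q] by (intro sum.cong) auto
    then show "(\<Sum>p\<in>A. a $ p * v $ p) = 0"
      using v(2)[OF A] by (simp flip: sum_distrib_left)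
  qed
  finally show "v \<in> {v \<in> polar_cone. a \<bullet> v = 0}" using v by simp
next
  fix v assume "v \<in> {v \<in> polar_cone. a \<bullet> v = 0}"
  then have v: "v \<in> polar_cone" "a \<bullet> v = 0" by auto
  \<comment> \<open>The extra element \<open>1\<close> makes the minimum meaningful also when \<open>a\<close> is constant.\<close>
  define gaps where "gaps = insert 1 {a $ x - a $ y |x y. a $ y < a $ x}"
  have "{a $ x - a $ y |x y. a $ y < a $ x} \<subseteq> (\<lambda>(x, y). a $ x - a $ y) ` UNIV" by auto
  then have "finite {a $ x - a $ y |x y. a $ y < a $ x}" by (rule finite_subset) simp
  then have fin: "finite gaps" by (simp add: gaps_def)
  define e where "e = Min gaps"
  have e_pos: "e > 0"
    using fin by (auto simp: e_def gaps_def Min_gr_iff)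
  have e_le: "e \<le> a $ x - a $ y" if "a $ y < a $ x" for x y
    unfolding e_def using fin that by (intro Min_le) (auto simp: gaps_def)
  have "(\<Sum>p\<in>B. v $ p) = 0" if B: "B \<in> \<pi>" for B
  proof -
    have perturb: "s * (\<Sum>p\<in>B. v $ p) \<le> 0" if s: "\<bar>s\<bar> \<le> e" for s
    proof -
      define b where "b = (\<chi> p. a $ p + s * of_bool (p \<in> B))"
      have "b $ y \<le> b $ x" if le: "x \<le> y" for x y
      proof -
        obtain X Y where X: "X \<in> \<pi>" "x \<in> X" and Y: "Y \<in> \<pi>" "y \<in> Y"
          using block_containing[OF part] by metis
        show ?thesis
        proof (cases "X = Y")
          case True
          then have "x \<in> B \<longleftrightarrow> y \<in> B" using block_unique[OF part B] X Y by metis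
          then show ?thesis using const[of X x y] X Y True by (simp add: b_def)
        next
          case False
          have "e \<le> a $ x - a $ y" using e_le strict[OF X(1) Y(1) False X(2) Y(2) le] by simp
          moreover have "\<not> (x \<in> B \<and> y \<in> B)" using block_unique[OF part] B X Y False by metis
          ultimately show ?thesis using s e_pos by (auto simp: b_def abs_le_iff)
        qed
      qed
      then have "b \<bullet> v \<le> 0" using antitone_inner_nonpos[OF v(1)] by blast
      moreover have "b \<bullet> v = a \<bullet> v + s * (\<Sum>p\<in>B. v $ p)"
      proof -
        have "s * (\<Sum>p\<in>B. v $ p) = (\<Sum>p\<in>UNIV. if p \<in> B then s * v $ p else 0)"
          by (simp add: sum_distrib_left sum.If_cases)
        then show ?thesis
          by (simp add: inner_vec_def flip: sum.distrib)
            (rule sum.cong, auto simp: b_def algebra_simps)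
      qed
      ultimately show ?thesis using v(2) by simp
    qed
    show ?thesis
      using perturb[of e] perturb[of "- e"] e_pos
      by (simp add: mult_le_0_iff zero_le_mult_iff)
  qed
  then show "v \<in> partition_face polar_cone \<pi>" using v by (simp add: partition_face_def)
qed

lemma antitone_kernel_is_face:
  fixes a :: "real ^ 'p::{finite, order}"
  assumes "\<And>x y. x \<le> y \<Longrightarrow> a $ y \<le> a $ x"
  shows "is_face polar_cone {v \<in> polar_cone. a \<bullet> v = 0}"
  unfolding is_face_def
proof (intro exI[of _ a] Collect_cong conj_cong refl)
  fix v :: "real ^ 'p::{finite, order}" assume v: "v \<in> polar_cone"
  show "a \<bullet> v = 0 \<longleftrightarrow> (\<forall>w\<in>polar_cone. a \<bullet> w \<le> a \<bullet> v)"
    using antitone_inner_nonpos[OF _ assms] v zero_in_polar_cone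
    by (metis antisym inner_zero_right)
qed

text \<open>The witness assigns to \<open>x\<close> the number of blocks above the block of \<open>x\<close>. Passing to a strictly
  larger block loses at least the block one started from, by antisymmetry; this is where
  compatibility enters.\<close>

lemma compatible_partition_face:
  fixes \<pi> :: "'p::{finite, order} set set"
  assumes "compatible_partition \<pi>"
  shows "is_face polar_cone (partition_face polar_cone \<pi>)"
proof -
  let ?R = "(block_le \<pi>)\<^sup>+"
  have part: "partition_on UNIV \<pi>" and po: "partial_order_on \<pi> ?R"
    using assms by (auto simp: compatible_partition_def)
  have "trans ?R" "antisym ?R" "refl_on \<pi> ?R"
    using po by (auto simp: partial_order_on_def preorder_on_def)
  define up where "up x = {C. \<exists>A\<in>\<pi>. x \<in> A \<and> (A, C) \<in> ?R}" for x
  have up: "up x = ?R `` {A}" if "A \<in> \<pi>" "x \<in> A" for A x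
    using that block_unique[OF part] by (auto simp: up_def)
  define a where "a = (\<chi> x. real (card (up x)))"
  have const: "a $ x = a $ y" if "A \<in> \<pi>" "x \<in> A" "y \<in> A" for A x y
    using that by (simp add: a_def up)
  have strict: "a $ y < a $ x"
    if "A \<in> \<pi>" "B \<in> \<pi>" "A \<noteq> B" "x \<in> A" "y \<in> B" "x \<le> y" for A B x y
  proof -
    have AB: "(A, B) \<in> ?R" using that by (auto simp: block_le_def)
    have up_x: "up x = ?R `` {A}" and up_y: "up y = ?R `` {B}" using up that by auto
    have "up y \<subseteq> up x"
      unfolding up_x up_y using AB \<open>trans ?R\<close> by (auto dest: transD)
    moreover have "A \<in> up x"
      unfolding up_x using that(1) \<open>refl_on \<pi> ?R\<close> by (simp add: refl_onD)
    moreover have "A \<notin> up y"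
      unfolding up_y using AB that(3) \<open>antisym ?R\<close> by (auto dest: antisymD)
    ultimately have "up y \<subset> up x" by blast
    then show ?thesis by (simp add: a_def psubset_card_mono)
  qed
  have anti: "a $ y \<le> a $ x" if "x \<le> y" for x y
  proof -
    obtain X Y where "X \<in> \<pi>" "x \<in> X" "Y \<in> \<pi>" "y \<in> Y"
      using block_containing[OF part] by metis
    then show ?thesis using const[of X x y] strict[of X Y x y] that by (cases "X = Y") auto
  qed
  have "partition_face polar_cone \<pi> = {v \<in> polar_cone. a \<bullet> v = 0}"
    using part const strict by (rule partition_face_eq_kernel)
  with antitone_kernel_is_face[OF anti] show ?thesis by simp
qed

text \<open>
  The blocks are the connected components of the fibres of \<open>a\<close>, that is the classes of the
  equivalence relation generated by comparability of elements with equal value. Fibres themselves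
  would do for the perturbation argument, but they need not be connected. Comparable elements of
  different components have different values, hence \<open>a\<close> is strict across blocks.
\<close>

lemma antitone_kernel_is_partition_face:
  fixes a :: "real ^ 'p::{finite, order}"
  assumes anti: "\<And>x y. x \<le> y \<Longrightarrow> a $ y \<le> a $ x"
  obtains \<pi> where "connected_partition \<pi>" "compatible_partition \<pi>"
    "partition_face polar_cone \<pi> = {v \<in> polar_cone. a \<bullet> v = 0}"
proof -
  define s where "s = {(x, y). a $ x = a $ y \<and> (x \<le> y \<or> y \<le> x)}"
  define \<pi> where "\<pi> = UNIV // s\<^sup>*"
  have "sym s" by (auto simp: s_def sym_def)
  then have eq: "equiv UNIV (s\<^sup>*)"
    by (auto simp: equiv_def refl_rtrancl trans_rtrancl sym_rtrancl)
  have part: "partition_on UNIV \<pi>" unfolding \<pi>_def using eq by (rule partition_on_quotient)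
  have fibre: "a $ x = a $ y" if "(x, y) \<in> s\<^sup>*" for x y
    using that by induction (auto simp: s_def)
  have same: "(x, y) \<in> s\<^sup>*" if "A \<in> \<pi>" "x \<in> A" "y \<in> A" for A x y
    using that eq unfolding \<pi>_def by (meson quotient_eq_iff)
  have merge: "A = B" if "A \<in> \<pi>" "B \<in> \<pi>" "x \<in> A" "y \<in> B" "(x, y) \<in> s\<^sup>*" for A B x y
    using that eq unfolding \<pi>_def by (meson quotient_eqI)
  have const: "a $ x = a $ y" if "A \<in> \<pi>" "x \<in> A" "y \<in> A" for A x y
    using fibre same that by blast
  have strict: "a $ y < a $ x"
    if "A \<in> \<pi>" "B \<in> \<pi>" "A \<noteq> B" "x \<in> A" "y \<in> B" "x \<le> y" for A B x y
  proof -
    have "(x, y) \<notin> s" using merge that by blast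
    then show ?thesis using anti[OF that(6)] that(6) by (auto simp: s_def)
  qed
  have "connected_poset A" if A: "A \<in> \<pi>" for A
    unfolding connected_poset_def
  proof (intro ballI)
    fix x y assume x: "x \<in> A" and y: "y \<in> A"
    have "(x, y) \<in> s\<^sup>*" using same A x y by blast
    \<comment> \<open>A chain of generating steps never leaves \<open>A\<close>, so each step is a zigzag inside \<open>A\<close>.\<close>
    then have "y \<in> A \<and> (x, y) \<in> (hasse A \<union> (hasse A)\<inverse>)\<^sup>*"
    proof induction
      case base
      then show ?case using x by simp
    next
      case (step y z)
      obtain B where B: "B \<in> \<pi>" "z \<in> B" using block_containing[OF part] by metis
      have "z \<in> A" using merge[of A B y z] A B step by auto
      moreover have "(y, z) \<in> (hasse A \<union> (hasse A)\<inverse>)\<^sup>*"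
        using zigzag_connected[of A y z] \<open>z \<in> A\<close> step by (auto simp: s_def)
      ultimately show ?case using step by (meson rtrancl_trans)
    qed
    then show "(x, y) \<in> (hasse A \<union> (hasse A)\<inverse>)\<^sup>*" by simp
  qed
  then have conn: "connected_partition \<pi>" using part by (simp add: connected_partition_def)
  let ?R = "(block_le \<pi>)\<^sup>+"
  have R: "A \<in> \<pi> \<and> B \<in> \<pi> \<and> (A \<noteq> B \<longrightarrow> (\<forall>x\<in>A. \<forall>y\<in>B. a $ y < a $ x))" if "(A, B) \<in> ?R" for A B
  proof -
    have one: "A \<in> \<pi> \<and> B \<in> \<pi> \<and> (A \<noteq> B \<longrightarrow> (\<forall>x\<in>A. \<forall>y\<in>B. a $ y < a $ x))"
      if "(A, B) \<in> block_le \<pi>" for A B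
    proof -
      from that obtain p q where pq: "A \<in> \<pi>" "B \<in> \<pi>" "p \<in> A" "q \<in> B" "p \<le> q" by (auto simp: block_le_def)
      have "a $ y < a $ x" if "A \<noteq> B" "x \<in> A" "y \<in> B" for x y
        using strict[OF pq(1,2) that(1) pq(3-5)] const[OF pq(1) that(2) pq(3)]
          const[OF pq(2) that(3) pq(4)] by simp
      then show ?thesis using pq by blast
    qed
    show ?thesis using that
    proof induction
      case (base C)
      then show ?case using one by blast
    next
      case (step B C)
      obtain q where q: "q \<in> B" using block_member[OF part] step.IH by metis
      show ?case using step.IH one[OF step.hyps(2)] q by (metis less_trans)
    qed
  qed
  have nonempty: "\<exists>x. x \<in> A" if "A \<in> \<pi>" for A using block_member[OF part that] by metis
  have "partial_order_on \<pi> ?R"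
    unfolding partial_order_on_def preorder_on_def
  proof (intro conjI)
    show "?R \<subseteq> \<pi> \<times> \<pi>" using R by auto
    show "refl_on \<pi> ?R"
    proof (rule refl_onI)
      fix A assume "A \<in> \<pi>"
      moreover from this obtain x where "x \<in> A" using nonempty by blast
      ultimately have "(A, A) \<in> block_le \<pi>" using order_refl[of x] unfolding block_le_def by blast
      then show "(A, A) \<in> ?R" by (rule r_into_trancl)
    qed
    show "trans ?R" by simp
    show "antisym ?R"
    proof (rule antisymI)
      fix A B assume AB: "(A, B) \<in> ?R" "(B, A) \<in> ?R"
      then show "A = B" using R[OF AB(1)] R[OF AB(2)] nonempty by (metis less_asym)
    qed
  qed
  then have "compatible_partition \<pi>" using part by (simp add: compatible_partition_def)
  moreover have "partition_face polar_cone \<pi> = {v \<in> polar_cone. a \<bullet> v = 0}"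
    using part const strict by (rule partition_face_eq_kernel)
  ultimately show ?thesis using conn that by simp
qed

text \<open>If \<open>p \<le> q\<close> lie in one block of \<open>\<pi>\<close>, then \<open>e\<^sub>q - e\<^sub>p\<close> lies in the face of \<open>\<pi>\<close>, hence in that of
  \<open>\<rho>\<close>. Its sum over a block of \<open>\<rho>\<close> can vanish only if that block contains both \<open>p\<close> and \<open>q\<close> or
  neither. Connectedness propagates this over the whole block of \<open>\<pi>\<close>.\<close>

lemma connected_partition_refines:
  fixes \<pi> \<rho> :: "'p::{finite, order} set set"
  assumes conn: "connected_partition \<pi>" and part: "partition_on UNIV \<rho>"
    and sub: "partition_face polar_cone \<pi> \<subseteq> partition_face polar_cone \<rho>"
    and AB: "A \<in> \<pi>" "B \<in> \<rho>" "x \<in> A" "x \<in> B"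
  shows "A \<subseteq> B"
proof
  have part': "partition_on UNIV \<pi>" and "connected_poset A"
    using conn AB by (auto simp: connected_partition_def)
  have same: "p \<in> D \<longleftrightarrow> q \<in> D" if pq: "p \<le> q" "p \<in> A" "q \<in> A" and D: "D \<in> \<rho>" for p q D
  proof -
    have "p \<in> E \<longleftrightarrow> q \<in> E" if "E \<in> \<pi>" for E
      using block_unique[OF part' AB(1) that] pq by metis
    then have "axis q 1 - axis p 1 \<in> partition_face polar_cone \<pi>"
      using root_in_polar_cone[OF pq(1)] by (simp add: partition_face_def root_sum)
    then show ?thesis
      using sub D root_sum[of q p D] by (auto simp: partition_face_def split: if_splits)
  qed
  fix y assume "y \<in> A"
  then have "(x, y) \<in> (hasse A \<union> (hasse A)\<inverse>)\<^sup>*"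
    using \<open>connected_poset A\<close> AB by (simp add: connected_poset_def)
  then show "y \<in> B"
  proof induction
    case (step y z)
    then show ?case using same[of y z B] same[of z y B] AB(2)
      by (auto simp: hasse_def dest: less_imp_le)
  qed (rule AB)
qed

theorem corollary3p7:
  assumes "connected_poset (UNIV :: 'p::{finite, order} set)"
  shows "bij_betw (partition_face (thin_cone TYPE('k::field)))
    {\<pi> :: 'p::{finite, order} set set. connected_partition \<pi> \<and> compatible_partition \<pi>}
    {F :: (real ^ 'p::{finite, order}) set. is_face (thin_cone TYPE('k::field)) F \<and> F \<noteq> {}}"
  unfolding thin_cone_eq_polar_cone
proof (rule bij_betw_imageI)
  show "inj_on (partition_face polar_cone)
    {\<pi> :: 'p set set. connected_partition \<pi> \<and> compatible_partition \<pi>}"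
  proof (rule inj_onI, clarify)
    fix \<pi> \<rho> :: "'p set set"
    assume conn: "connected_partition \<pi>" "connected_partition \<rho>"
      and eq: "partition_face polar_cone \<pi> = partition_face polar_cone \<rho>"
    have sub: "\<sigma> \<subseteq> \<tau>" if conn: "connected_partition \<sigma>" "connected_partition \<tau>"
      and eq: "partition_face polar_cone \<sigma> = partition_face polar_cone \<tau>"
    for \<sigma> \<tau> :: "'p set set"
    proof
      fix A assume A: "A \<in> \<sigma>"
      have part: "partition_on UNIV \<sigma>" "partition_on UNIV \<tau>"
        using conn by (auto simp: connected_partition_def)
      obtain x where x: "x \<in> A" using block_member[OF part(1) A] .
      obtain B where B: "B \<in> \<tau>" "x \<in> B" using block_containing[OF part(2)] .
      have "A \<subseteq> B" "B \<subseteq> A"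
        using connected_partition_refines[OF conn(1) part(2) _ A B(1) x B(2)]
          connected_partition_refines[OF conn(2) part(1) _ B(1) A B(2) x] eq by auto
      then show "A \<in> \<tau>" using B by auto
    qed
    show "\<pi> = \<rho>" using sub[OF conn eq] sub[OF conn(2,1) eq[symmetric]] by auto
  qed
  have "0 \<in> partition_face polar_cone \<pi>" for \<pi> :: "'p set set"
    by (simp add: partition_face_def zero_in_polar_cone)
  then have "partition_face polar_cone \<pi> \<noteq> {}" for \<pi> :: "'p set set" by blast
  moreover have "\<exists>\<pi>. connected_partition \<pi> \<and> compatible_partition \<pi> \<and> F = partition_face polar_cone \<pi>"
    if F: "is_face polar_cone F" "F \<noteq> {}" for F :: "(real ^ 'p::{finite, order}) set"
    using nonempty_face_functional[OF F] antitone_kernel_is_partition_face by metis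
  ultimately show "partition_face polar_cone `
      {\<pi> :: 'p set set. connected_partition \<pi> \<and> compatible_partition \<pi>} =
    {F. is_face polar_cone F \<and> F \<noteq> {}}"
    using compatible_partition_face by (auto simp: image_iff)
qed

end
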